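(* Let $d\ge2$, let $A\in\mathbb{R}^{d\times d}$, let $B\in\mathbb{R}^{d\times d}$ be symmetric positive definite, and let $f(v)=\langle v,Av\rangle$ on $\mathbb{S}_B^{d-1}$. Let $v^k\in\mathbb{S}_B^{d-1}$ be an iterate of the one-sample zeroth-order method, let $x^k$ be the random direction, $b_k=2\langle x^k,A^{\mathrm H}v^k\rangle$ and $\tau_k$ the step size as described in the context. Then $$ b_kx^k=2\,\widehat{\operatorname{grad}}_1 f(v^k)\qquad\text{and}\qquad \mathbb{E}_{x^k\sim X^k\mid V^k=v^k}[b_kx^k]=\tfrac{1}{d-1}\operatorname{grad} f(v^k), $$ where $\operatorname{grad} f(v^k)$ is the Riemannian gradient of $f$ on $\mathbb{S}_B^{d-1}$ and $\widehat{\operatorname{grad}}_1 f(v^k)$ is its zeroth-order one-sample approximation in direction $x^k$ with scaling parameter $\mu=\tau_k$.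
   Context: $\langle\cdot,\cdot\rangle$ and $\|\cdot\|$ are the Euclidean inner product and norm. Put $A^{\mathrm H}=\tfrac12(A+A^{\mathrm T})$, $\|v\|_B=\sqrt{\langle v,Bv\rangle}$, $\mathbb{S}_B^{d-1}=\{v\in\mathbb{R}^d:\|v\|_B=1\}$. For $v\in\mathbb{S}_B^{d-1}$ let $T_v=\{x\in\mathbb{R}^d:\langle x,Bv\rangle=0\}$ and let $P_v y=y-\frac{\langle y,Bv\rangle}{\|Bv\|^2}Bv$ be the Euclidean orthogonal projection onto $T_v$. The retraction is $R_v(x)=\frac{v+x}{\|v+x\|_B}$ for $x\in T_v$. The Riemannian gradient is $\operatorname{grad} f(v)=2P_vA^{\mathrm H}v$. Put $r(A,B,v)=\frac{\langle v,Av\rangle}{\langle v,Bv\rangle}$ for $v\neq0$. Given $V^k=v^k$, the direction is $x^k=P_{v^k}\tilde x/\|P_{v^k}\tilde x\|\in T_{v^k}$ with $\tilde x\sim\mathcal{N}(0,I_d)$ (independent of $v^k$), and $\mathbb{E}_{x^k\sim X^k\mid V^k=v^k}$ is the expectation over this direction with $v^k$ fixed. If $b_k\neq0$, $\tau_k=\operatorname{argmax}_{\tau\in\mathbb{R}} r(A,B,v^k+\tau x^k)$ (exists and is unique in this case); if $b_k=0$, one sets $\tau_k=0$. The zeroth-order one-sample approximation of the Riemannian gradient at $v^k$ in direction $x^k$ with scaling parameter $\mu$ is $$\widehat{\operatorname{grad}}_1 f(v^k)=\frac{f(R_{v^k}(\mu x^k))-f(v^k)}{\mu}\,x^k,$$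 where for $\mu=0$ the quotient $0/0$ is interpreted as $0$. *)

theory Defs
  imports "HOL-Probability.Probability"
begin

definition spd :: "real^'n^'n \<Rightarrow> bool" where
  "spd B \<longleftrightarrow> transpose B = B \<and> (\<forall>x. x \<noteq> 0 \<longrightarrow> 0 < x \<bullet> (B *v x))"

definition sym_part :: "real^'n^'n \<Rightarrow> real^'n^'n" where
  "sym_part A = (1/2) *\<^sub>R (A + transpose A)"

definition norm_wrt :: "real^'n^'n \<Rightarrow> real^'n \<Rightarrow> real" where
  "norm_wrt B v = sqrt (v \<bullet> (B *v v))"

definition sphere_wrt :: "real^'n^'n \<Rightarrow> (real^'n) set" where
  "sphere_wrt B = {v. norm_wrt B v = 1}"

definition tangent :: "real^'n^'n \<Rightarrow> real^'n \<Rightarrow> (real^'n) set" where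
  "tangent B v = {x. x \<bullet> (B *v v) = 0}"

definition proj :: "real^'n^'n \<Rightarrow> real^'n \<Rightarrow> real^'n \<Rightarrow> real^'n" where
  "proj B v y = y - ((y \<bullet> (B *v v)) / (norm (B *v v))\<^sup>2) *\<^sub>R (B *v v)"

definition retraction_at :: "real^'n^'n \<Rightarrow> real^'n \<Rightarrow> real^'n \<Rightarrow> real^'n" where
  "retraction_at B v x = (v + x) /\<^sub>R norm_wrt B (v + x)"

text \<open>The Riemannian gradient of \<open>w \<mapsto> w \<bullet> (A *v w)\<close> on \<open>sphere_wrt B\<close>, for the Euclidean
  metric on the tangent spaces; lemma \<open>riem_grad_iff\<close> below shows that the formula agrees with
  the characterization by directional derivatives.\<close>
definition riem_grad :: "real^'n^'n \<Rightarrow> real^'n^'n \<Rightarrow> real^'n \<Rightarrow> real^'n" where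
  "riem_grad A B v = 2 *\<^sub>R proj B v (sym_part A *v v)"

definition rayleigh :: "real^'n^'n \<Rightarrow> real^'n^'n \<Rightarrow> real^'n \<Rightarrow> real" where
  "rayleigh A B v = (v \<bullet> (A *v v)) / (v \<bullet> (B *v v))"

definition b_coeff :: "real^'n^'n \<Rightarrow> real^'n \<Rightarrow> real^'n \<Rightarrow> real" where
  "b_coeff A v x = 2 * (x \<bullet> (sym_part A *v v))"

text \<open>For \<open>v\<close> in \<open>sphere_wrt B\<close> and \<open>x\<close> in \<open>tangent B v\<close> with nonzero \<open>b_coeff A v x\<close>, the
  maximizer exists and is unique, so the choice made by \<open>arg_max\<close> plays no role.\<close>
definition step_size :: "real^'n^'n \<Rightarrow> real^'n^'n \<Rightarrow> real^'n \<Rightarrow> real^'n \<Rightarrow> real" where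
  "step_size A B v x =
     (if b_coeff A v x = 0 then 0
      else (ARG_MAX (\<lambda>\<tau>. rayleigh A B (v + \<tau> *\<^sub>R x)) \<tau>. True))"

text \<open>The value at \<open>\<mu> = 0\<close> is \<open>0\<close>, since \<open>0 / 0 = 0\<close>.\<close>
definition grad_est :: "real^'n^'n \<Rightarrow> (real^'n \<Rightarrow> real) \<Rightarrow> real^'n \<Rightarrow> real^'n \<Rightarrow> real \<Rightarrow> real^'n" where
  "grad_est B f v x \<mu> = ((f (retraction_at B v (\<mu> *\<^sub>R x)) - f v) / \<mu>) *\<^sub>R x"

definition std_gaussian :: "(real^'n) measure" where
  "std_gaussian = density lborel (\<lambda>x. ennreal (\<Prod>i\<in>UNIV. std_normal_density (x $ i)))"

text \<open>The direction obtained from the sample \<open>y\<close>. It is \<open>0\<close> when \<open>proj B v y = 0\<close>, which in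
  dimension at least two happens only on a null set of \<open>std_gaussian\<close>.\<close>
definition direction :: "real^'n^'n \<Rightarrow> real^'n \<Rightarrow> real^'n \<Rightarrow> real^'n" where
  "direction B v y = proj B v y /\<^sub>R norm (proj B v y)"

text \<open>The conditional law of the direction given the current iterate \<open>v\<close>; the Gaussian sample is
  independent of the iterate, so conditioning amounts to fixing \<open>v\<close>.\<close>
definition direction_law :: "real^'n^'n \<Rightarrow> real^'n \<Rightarrow> (real^'n) measure" where
  "direction_law B v = distr std_gaussian borel (direction B v)"

lemma prob_space_std_gaussian: "prob_space (std_gaussian :: (real^'n) measure)"
proof
  have inj: "inj (\<lambda>i::'n. axis i (1::real))"
    by (auto simp: inj_def axis_eq_axis)
  have B: "Basis = (\<lambda>i::'n. axis i (1::real)) ` UNIV"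
    by (auto simp: Basis_vec_def)
  have prodB: "(\<Prod>i\<in>UNIV. std_normal_density (x $ i)) = (\<Prod>b\<in>Basis. std_normal_density (x \<bullet> b))"
    for x :: "real^'n"
    unfolding B by (subst prod.reindex[OF inj]) (simp add: inner_axis)
  have one: "(\<integral>\<^sup>+t. ennreal (std_normal_density t) \<partial>lborel) = 1"
    using prob_space.emeasure_space_1[OF prob_space_normal_density[of 1 0]]
    by (simp add: emeasure_density)
  have "emeasure (std_gaussian :: (real^'n) measure) (space std_gaussian) =
      (\<integral>\<^sup>+x. ennreal (\<Prod>b\<in>Basis. std_normal_density (x \<bullet> b)) \<partial>(lborel :: (real^'n) measure))"
    unfolding std_gaussian_def by (simp add: emeasure_density prodB)
  also have "\<dots> = (\<integral>\<^sup>+x. (\<Prod>b\<in>Basis. ennreal (std_normal_density (x \<bullet> b)))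
      \<partial>(lborel :: (real^'n) measure))"
    by (simp add: prod_ennreal)
  also have "\<dots> = (\<Prod>b\<in>(Basis :: (real^'n) set). (\<integral>\<^sup>+t. ennreal (std_normal_density t) \<partial>lborel))"
    by (rule nn_integral_lborel_prod) auto
  finally show "emeasure (std_gaussian :: (real^'n) measure) (space std_gaussian) = 1"
    by (simp add: one)
qed

lemma quad_sum:
  fixes M :: "real^'n^'n"
  shows "(v + t *\<^sub>R x) \<bullet> (M *v (v + t *\<^sub>R x)) =
    v \<bullet> (M *v v) + t * b_coeff M v x + t\<^sup>2 * (x \<bullet> (M *v x))"
proof -
  have "x \<bullet> (sym_part M *v v) = (x \<bullet> (M *v v) + v \<bullet> (M *v x)) / 2"
    unfolding sym_part_def
    by (simp add: scaleR_matrix_vector_assoc[symmetric] matrix_vector_mult_add_rdistrib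
        inner_add_right dot_lmul_matrix[symmetric] inner_commute)
  then show ?thesis
    unfolding b_coeff_def
    by (simp add: matrix_vector_right_distrib matrix_vector_mult_scaleR inner_add_left
        inner_add_right power2_eq_square algebra_simps)
qed

lemma riem_grad_iff:
  assumes B: "spd B" and v: "v \<in> sphere_wrt B"
    and f: "\<And>w. w \<in> sphere_wrt B \<Longrightarrow> f w = w \<bullet> (A *v w)"
  shows "g = riem_grad A B v \<longleftrightarrow>
    g \<in> tangent B v \<and>
    (\<forall>x\<in>tangent B v. ((\<lambda>t. f (retraction_at B v (t *\<^sub>R x))) has_real_derivative g \<bullet> x) (at 0))"
    (is "_ \<longleftrightarrow> ?T g \<and> ?D g")
proof -
  have vB: "v \<bullet> (B *v v) = 1" using v by (simp add: sphere_wrt_def norm_wrt_def)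
  then have Bv: "B *v v \<noteq> 0" by auto
  have T: "?T (riem_grad A B v)"
    using Bv by (simp add: riem_grad_def tangent_def proj_def inner_diff_left power2_norm_eq_inner)
  have inner: "riem_grad A B v \<bullet> x = b_coeff A v x" if "x \<in> tangent B v" for x
    using that by (simp add: riem_grad_def tangent_def proj_def inner_diff_right b_coeff_def
        inner_commute)
  have D: "((\<lambda>t. f (retraction_at B v (t *\<^sub>R x))) has_real_derivative b_coeff A v x) (at 0)"
    if x: "x \<in> tangent B v" for x
  proof -
    have symB: "sym_part B = B"
      using B by (simp add: spd_def sym_part_def flip: scaleR_2)
    have den: "(v + t *\<^sub>R x) \<bullet> (B *v (v + t *\<^sub>R x)) = 1 + t\<^sup>2 * (x \<bullet> (B *v x))" for t
      using x by (simp add: quad_sum vB b_coeff_def symB tangent_def)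
    have e: "0 \<le> x \<bullet> (B *v x)"
      using B by (cases "x = 0") (auto simp: spd_def less_imp_le)
    have pos: "0 < 1 + t\<^sup>2 * (x \<bullet> (B *v x))" for t
      using e by (simp add: add_pos_nonneg)
    have feq: "f (retraction_at B v (t *\<^sub>R x)) =
        (v \<bullet> (A *v v) + t * b_coeff A v x + t\<^sup>2 * (x \<bullet> (A *v x))) / (1 + t\<^sup>2 * (x \<bullet> (B *v x)))" for t
    proof -
      let ?w = "v + t *\<^sub>R x"
      have n: "norm_wrt B ?w * norm_wrt B ?w = 1 + t\<^sup>2 * (x \<bullet> (B *v x))"
        unfolding norm_wrt_def den using pos[of t] by simp
      have s: "(?w /\<^sub>R norm_wrt B ?w) \<bullet> (M *v (?w /\<^sub>R norm_wrt B ?w)) =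
          (?w \<bullet> (M *v ?w)) / (norm_wrt B ?w * norm_wrt B ?w)" for M
        by (simp add: matrix_vector_mult_scaleR divide_inverse del: scaleR_add_right)
      have "retraction_at B v (t *\<^sub>R x) \<in> sphere_wrt B"
        unfolding retraction_at_def sphere_wrt_def mem_Collect_eq
        by (subst norm_wrt_def, subst s, subst n, subst den) (use pos[of t] in simp)
      from f[OF this] show ?thesis
        unfolding retraction_at_def s n quad_sum[of v t x A] .
    qed
    show ?thesis
      unfolding feq by (rule derivative_eq_intros refl | use pos in simp)+
  qed
  show ?thesis
  proof
    assume "g = riem_grad A B v"
    then show "?T g \<and> ?D g" using T D inner by simp
  next
    assume g: "?T g \<and> ?D g"
    let ?h = "g - riem_grad A B v"
    have h: "?h \<in> tangent B v" using g T by (simp add: tangent_def inner_diff_left)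
    have "g \<bullet> ?h = riem_grad A B v \<bullet> ?h"
      using DERIV_unique g h D inner by metis
    then have "?h \<bullet> ?h = 0" by (simp add: inner_diff_left)
    then show "g = riem_grad A B v" by simp
  qed
qed

end

theory Submission
  imports Defs
begin

text \<open>On the line \<open>v + t x\<close> the Rayleigh quotient minus its value at \<open>v\<close> is
  \<open>(t b + t\<^sup>2 \<delta>) / (1 + t\<^sup>2 \<beta>)\<close>. If \<open>l\<close> is its maximum, then \<open>l (1 + t\<^sup>2 \<beta>) - (t b + t\<^sup>2 \<delta>)\<close> is a
  nonnegative quadratic with a double root at the maximizer, which gives \<open>t = 2 l / b\<close>, that is
  \<open>b = 2 l / t\<close>. For the expectation, the law of the direction is invariant under the reflections
  that fix \<open>B v\<close>, so its second moment matrix is a multiple of the projection onto the tangent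
  space; the direction has norm one, so the trace makes that multiple \<open>1 / (d - 1)\<close>.\<close>

section \<open>The step size\<close>

lemma rayleigh_line_maximizer:
  fixes b \<beta> \<delta> :: real
  assumes b: "b \<noteq> 0" and \<beta>: "\<beta> > 0"
  obtains l where "l > 0"
    and "\<And>t. (t * b + t\<^sup>2 * \<delta>) / (1 + t\<^sup>2 * \<beta>) \<le> l"
    and "\<And>t. (t * b + t\<^sup>2 * \<delta>) / (1 + t\<^sup>2 * \<beta>) = l \<longleftrightarrow> t = 2 * l / b"
proof -
  define s where "s = sqrt (\<delta>\<^sup>2 + \<beta> * b\<^sup>2)"
  \<comment> \<open>The positive root of
    \<open>4 * (l * (l * \<beta> - \<delta>)) = b\<^sup>2\<close>. This equation says that the
    quadratic \<open>(l * \<beta> - \<delta>) * t\<^sup>2 - b * t + l\<close> in \<open>t\<close>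
    has discriminant zero.\<close>
  define l where "l = (\<delta> + s) / (2 * \<beta>)"
  have pos: "\<beta> * b\<^sup>2 > 0" using b \<beta> by simp
  have s2: "s\<^sup>2 = \<delta>\<^sup>2 + \<beta> * b\<^sup>2"
    unfolding s_def using pos by (simp add: add_nonneg_nonneg)
  have "\<bar>\<delta>\<bar> < s"
    unfolding s_def using pos by (intro real_less_rsqrt) simp
  then have sd: "\<delta> + s > 0" by linarith
  have l: "l > 0" unfolding l_def using sd \<beta> by simp
  have ls: "2 * \<beta> * l = \<delta> + s" unfolding l_def using \<beta> by simp
  have "4 * \<beta> * (l * (l * \<beta> - \<delta>)) = (2 * \<beta> * l) * (2 * \<beta> * l - 2 * \<delta>)"
    by (simp add: algebra_simps)
  also have "\<dots> = \<beta> * b\<^sup>2"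
    unfolding ls using s2 by (simp add: algebra_simps power2_eq_square)
  finally have key: "4 * (l * (l * \<beta> - \<delta>)) = b\<^sup>2" using \<beta> by simp
  \<comment> \<open>The positive factor \<open>4 * l\<close> completes the square, so a single
    identity yields both the upper bound and the equality case.\<close>
  have sq: "4 * l * (l * (1 + t\<^sup>2 * \<beta>) - (t * b + t\<^sup>2 * \<delta>)) = (t * b - 2 * l)\<^sup>2" for t
  proof -
    have "4 * l * (l * (1 + t\<^sup>2 * \<beta>) - (t * b + t\<^sup>2 * \<delta>)) =
        4 * l\<^sup>2 + t\<^sup>2 * (4 * (l * (l * \<beta> - \<delta>))) - 4 * l * t * b"
      by (simp add: algebra_simps power2_eq_square)
    also have "\<dots> = (t * b - 2 * l)\<^sup>2"
      unfolding key by (simp add: algebra_simps power2_eq_square)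
    finally show ?thesis .
  qed
  have den: "1 + t\<^sup>2 * \<beta> > 0" for t
    using \<beta> by (simp add: add_pos_nonneg)
  show ?thesis
  proof (rule that[OF l])
    fix t
    have "0 \<le> 4 * l * (l * (1 + t\<^sup>2 * \<beta>) - (t * b + t\<^sup>2 * \<delta>))"
      unfolding sq by simp
    then have "t * b + t\<^sup>2 * \<delta> \<le> l * (1 + t\<^sup>2 * \<beta>)"
      using l by (simp add: zero_le_mult_iff)
    then show "(t * b + t\<^sup>2 * \<delta>) / (1 + t\<^sup>2 * \<beta>) \<le> l"
      using den[of t] by (simp add: divide_le_eq)
    have "(t * b + t\<^sup>2 * \<delta>) / (1 + t\<^sup>2 * \<beta>) = l \<longleftrightarrow>
        4 * l * (l * (1 + t\<^sup>2 * \<beta>) - (t * b + t\<^sup>2 * \<delta>)) = 0"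
      using den[of t] l by (auto simp: divide_eq_eq)
    also have "\<dots> \<longleftrightarrow> t * b = 2 * l" unfolding sq by simp
    also have "\<dots> \<longleftrightarrow> t = 2 * l / b" using b by (auto simp: eq_divide_eq)
    finally show "(t * b + t\<^sup>2 * \<delta>) / (1 + t\<^sup>2 * \<beta>) = l \<longleftrightarrow> t = 2 * l / b" .
  qed
qed

lemma b_coeff_step_size:
  assumes B: "spd B" and v: "v \<in> sphere_wrt B" and x: "x \<in> tangent B v"
    and b: "b_coeff A v x \<noteq> 0"
  shows "2 * ((rayleigh A B (v + step_size A B v x *\<^sub>R x) - v \<bullet> (A *v v)) / step_size A B v x)
    = b_coeff A v x"
proof -
  let ?b = "b_coeff A v x" and ?\<alpha> = "v \<bullet> (A *v v)" and ?\<beta> = "x \<bullet> (B *v x)"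
  \<comment> \<open>Since \<open>v\<close> has \<open>B\<close>-norm 1 and \<open>x\<close> is
    tangent, the denominator along the line is \<open>1 + t\<^sup>2 * ?\<beta>\<close> with no
    linear term. Subtracting \<open>?\<alpha>\<close> times it from the numerator leaves
    \<open>?\<delta>\<close> as the quadratic coefficient.\<close>
  let ?\<delta> = "x \<bullet> (A *v x) - ?\<alpha> * ?\<beta>"
  let ?r = "\<lambda>t. rayleigh A B (v + t *\<^sub>R x)"
  have vB: "v \<bullet> (B *v v) = 1" using v by (simp add: sphere_wrt_def norm_wrt_def)
  have "x \<noteq> 0" using b by (auto simp: b_coeff_def)
  then have \<beta>: "?\<beta> > 0" using B by (simp add: spd_def)
  have symB: "sym_part B = B"
    using B by (simp add: spd_def sym_part_def flip: scaleR_2)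
  have pos: "1 + t\<^sup>2 * ?\<beta> > 0" for t using \<beta> by (simp add: add_pos_nonneg)
  define g where "g t = (t * ?b + t\<^sup>2 * ?\<delta>) / (1 + t\<^sup>2 * ?\<beta>)" for t
  have r: "?r t = ?\<alpha> + g t" for t
  proof -
    have "?r t = (?\<alpha> + t * ?b + t\<^sup>2 * (x \<bullet> (A *v x))) / (1 + t\<^sup>2 * ?\<beta>)"
      using x unfolding rayleigh_def
      by (simp add: quad_sum vB b_coeff_def[of B] symB tangent_def)
    also have "\<dots> = ?\<alpha> + g t"
      using pos[of t] by (simp add: g_def field_simps)
    finally show ?thesis .
  qed
  obtain l where l: "l > 0" and le: "\<And>t. g t \<le> l"
    and eq: "\<And>t. g t = l \<longleftrightarrow> t = 2 * l / ?b"
    using rayleigh_line_maximizer[OF b \<beta>, where \<delta> = ?\<delta>, folded g_def] by blast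
  have top: "?r (2 * l / ?b) = ?\<alpha> + l"
    by (simp only: r eq[THEN iffD2, OF refl])
  have "?r (ARG_MAX ?r t. True) = ?r (2 * l / ?b)"
  proof (rule arg_max_equality)
    show "?r t \<le> ?r (2 * l / ?b)" for t
      by (simp only: r eq[THEN iffD2, OF refl] add_le_cancel_left le)
  qed simp
  then have "?r (step_size A B v x) = ?\<alpha> + l"
    using b top by (simp add: step_size_def)
  \<comment> \<open>So far only the value attained at the step size is known; the uniqueness in
    \<open>eq\<close> identifies the step size itself.\<close>
  moreover from this have "step_size A B v x = 2 * l / ?b"
    using eq by (simp add: r)
  ultimately show ?thesis using l b by simp
qed

text \<open>The Rayleigh quotient is unchanged by scaling, and its denominator is 1 on the sphere;
  hence normalizing \<open>v + x\<close> turns the quotient into the plain quadratic form.\<close>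

lemma form_retraction:
  assumes B: "spd B" and nz: "v + x \<noteq> 0"
    and f: "\<And>w. w \<in> sphere_wrt B \<Longrightarrow> f w = w \<bullet> (A *v w)"
  shows "f (retraction_at B v x) = rayleigh A B (v + x)"
proof -
  let ?w = "v + x"
  have pos: "?w \<bullet> (B *v ?w) > 0" using B nz by (simp add: spd_def)
  then have n: "norm_wrt B ?w * norm_wrt B ?w = ?w \<bullet> (B *v ?w)"
    unfolding norm_wrt_def by simp
  have s: "(?w /\<^sub>R norm_wrt B ?w) \<bullet> (M *v (?w /\<^sub>R norm_wrt B ?w)) =
      (?w \<bullet> (M *v ?w)) / (norm_wrt B ?w * norm_wrt B ?w)" for M
    by (simp add: matrix_vector_mult_scaleR divide_inverse del: scaleR_add_right)
  have "retraction_at B v x \<in> sphere_wrt B"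
    unfolding retraction_at_def sphere_wrt_def mem_Collect_eq
    by (subst norm_wrt_def, subst s, subst n) (use pos in simp)
  from f[OF this] show ?thesis
    unfolding retraction_at_def s n rayleigh_def .
qed

lemma grad_est_step_size:
  assumes B: "spd B" and v: "v \<in> sphere_wrt B" and x: "x \<in> tangent B v"
    and f: "\<And>w. w \<in> sphere_wrt B \<Longrightarrow> f w = w \<bullet> (A *v w)"
  shows "b_coeff A v x *\<^sub>R x = 2 *\<^sub>R grad_est B f v x (step_size A B v x)"
proof (cases "b_coeff A v x = 0")
  case True
  \<comment> \<open>Both sides are 0: the step size is 0, and division by 0 gives 0, the convention
    for \<mu> = 0.\<close>
  then show ?thesis by (simp add: step_size_def grad_est_def)
next
  case False
  let ?t = "step_size A B v x"
  \<comment> \<open>The step is tangent, so the inner product of the moved point with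
    \<open>B *v v\<close> stays equal to 1.\<close>
  have "v + ?t *\<^sub>R x \<noteq> 0"
  proof
    assume "v + ?t *\<^sub>R x = 0"
    then have "(v + ?t *\<^sub>R x) \<bullet> (B *v v) = 0" by simp
    then show False
      using v x by (simp add: inner_add_left tangent_def sphere_wrt_def norm_wrt_def)
  qed
  then have "f (retraction_at B v (?t *\<^sub>R x)) = rayleigh A B (v + ?t *\<^sub>R x)"
    using form_retraction[OF B _ f] by blast
  then show ?thesis
    using b_coeff_step_size[OF B v x False] f[OF v] by (simp add: grad_est_def)
qed

section \<open>Orthogonal invariance of the Gaussian\<close>

lemma orthogonal_transformation_borel_measurable:
  fixes f :: "'a::euclidean_space \<Rightarrow> 'a"
  assumes "orthogonal_transformation f"
  shows "f \<in> borel_measurable borel"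
  using assms by (intro borel_measurable_continuous_onI linear_continuous_on
      linear_conv_bounded_linear[THEN iffD1] orthogonal_transformation_linear)

text \<open>Uniqueness of Haar measure: integrating \<open>indicator U x * indicator S (f y + x)\<close>
  for the unit ball \<open>U\<close> over \<open>x\<close> and \<open>y\<close> in both orders compares the two measures on \<open>S\<close>,
  because \<open>f\<close> preserves balls.\<close>
lemma lborel_distr_orthogonal_transformation:
  fixes f :: "'a::euclidean_space \<Rightarrow> 'a"
  assumes f: "orthogonal_transformation f"
  shows "distr lborel borel f = lborel"
proof (rule measure_eqI)
  have lin: "linear f" using f by (rule orthogonal_transformation_linear)
  have [measurable]: "f \<in> borel_measurable borel"
    using f by (rule orthogonal_transformation_borel_measurable)
  obtain g where fg: "\<And>x. f (g x) = x"
    using orthogonal_transformation_surj[OF f] by (metis surjD)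
  fix S assume "S \<in> sets (distr lborel borel f)"
  then have [measurable]: "S \<in> sets borel" by simp
  define U where "U = ball (0::'a) 1"
  have [measurable]: "U \<in> sets borel" by (simp add: U_def)
  let ?V = "emeasure lborel U"
  have "unit_ball_vol (real DIM('a)) \<noteq> 0"
    by (rule less_imp_neq[THEN not_sym]) simp
  then have V: "?V \<noteq> 0" "?V \<noteq> \<infinity>"
    by (simp_all add: U_def emeasure_ball)
  \<comment> \<open>Norm preservation enters here: the points that \<open>f\<close> sends into the
    unit ball around \<open>x\<close> form the unit ball around \<open>g x\<close>.\<close>
  have ball: "(\<integral>\<^sup>+y. indicator U (x - f y) \<partial>lborel) = ?V" for x
  proof -
    have "x - f y \<in> U \<longleftrightarrow> y \<in> ball (g x) 1" for y
    proof -
      have "norm (x - f y) = norm (f (g x - y))"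
        using lin by (simp add: linear_diff fg)
      then show ?thesis
        using f by (simp add: U_def orthogonal_transformation_norm dist_norm
            norm_minus_commute[of "f y"])
    qed
    then have "(\<integral>\<^sup>+y. indicator U (x - f y) \<partial>lborel) =
        (\<integral>\<^sup>+y. indicator (ball (g x) 1) y \<partial>lborel)"
      by (intro nn_integral_cong) (simp add: indicator_def)
    also have "\<dots> = ?V" by (simp add: U_def emeasure_ball)
    finally show ?thesis .
  qed
  have translate: "(\<integral>\<^sup>+y. h (c + y) \<partial>lborel) = (\<integral>\<^sup>+y. h y \<partial>lborel)"
    if [measurable]: "h \<in> borel_measurable borel" for h :: "'a \<Rightarrow> ennreal" and c
    by (subst (2) lborel_distr_plus[of c, symmetric]) (simp add: nn_integral_distr)
  have "emeasure (distr lborel borel f) S = (\<integral>\<^sup>+y. indicator S (f y) \<partial>lborel)"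
    by (subst nn_integral_indicator[of S "distr lborel borel f", symmetric])
      (simp_all add: nn_integral_distr del: nn_integral_indicator)
  then have "?V * emeasure (distr lborel borel f) S =
      (\<integral>\<^sup>+x. indicator U x * (\<integral>\<^sup>+y. indicator S (f y) \<partial>lborel) \<partial>lborel)"
    by (subst nn_integral_multc) simp_all
  \<comment> \<open>Shifting \<open>y\<close> by \<open>g x\<close> does not change the inner
    integral; linearity then turns \<open>f (g x + y)\<close> into \<open>x + f y\<close>.\<close>
  also have "\<dots> = (\<integral>\<^sup>+x. indicator U x * (\<integral>\<^sup>+y. indicator S (f (g x + y)) \<partial>lborel) \<partial>lborel)"
    by (subst translate) simp_all
  also have "\<dots> = (\<integral>\<^sup>+x. (\<integral>\<^sup>+y. indicator U x * indicator S (f y + x) \<partial>lborel) \<partial>lborel)"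
    using lin by (subst nn_integral_cmult) (simp_all add: linear_add fg add.commute)
  also have "\<dots> = (\<integral>\<^sup>+y. (\<integral>\<^sup>+x. indicator U x * indicator S (f y + x) \<partial>lborel) \<partial>lborel)"
    by (rule lborel_pair.Fubini') measurable
  also have "\<dots> = (\<integral>\<^sup>+y. (\<integral>\<^sup>+x. indicator U (x - f y) * indicator S x \<partial>lborel) \<partial>lborel)"
  proof (rule nn_integral_cong)
    fix y
    show "(\<integral>\<^sup>+x. indicator U x * indicator S (f y + x) \<partial>lborel) =
        (\<integral>\<^sup>+x. indicator U (x - f y) * indicator S x \<partial>lborel)"
      using translate[of "\<lambda>x. indicator U (x - f y) * indicator S x" "f y"] by simp
  qed
  also have "\<dots> = (\<integral>\<^sup>+x. (\<integral>\<^sup>+y. indicator U (x - f y) * indicator S x \<partial>lborel) \<partial>lborel)"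
    by (rule lborel_pair.Fubini') measurable
  also have "\<dots> = (\<integral>\<^sup>+x. ?V * indicator S x \<partial>lborel)"
    by (subst nn_integral_multc) (simp_all add: ball)
  also have "\<dots> = ?V * emeasure lborel S"
    by (subst nn_integral_cmult) simp_all
  finally show "emeasure (distr lborel borel f) S = emeasure lborel S"
    using V by (simp add: ennreal_mult_cancel_left)
qed simp

lemma power2_norm_eq_sum_cart: "(norm x)\<^sup>2 = (\<Sum>i\<in>UNIV. (x $ i)\<^sup>2)" for x :: "real^'n"
  by (simp add: norm_vec_def L2_set_def sum_nonneg)

text \<open>The density is radial, which makes the Gaussian inherit the invariance of Lebesgue
  measure under orthogonal maps.\<close>

lemma prod_std_normal_density:
  fixes x :: "real^'n"
  shows "(\<Prod>i\<in>UNIV. std_normal_density (x $ i)) =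
    (1 / sqrt (2 * pi)) ^ CARD('n) * exp (- (norm x)\<^sup>2 / 2)"
proof -
  have "(\<Prod>i\<in>UNIV. exp (- (x $ i)\<^sup>2 / 2)) = exp (\<Sum>i\<in>UNIV. - (x $ i)\<^sup>2 / 2)"
    by (rule exp_sum[symmetric]) simp
  also have "(\<Sum>i\<in>UNIV. - (x $ i)\<^sup>2 / 2) = - (norm x)\<^sup>2 / 2"
    by (simp only: power2_norm_eq_sum_cart sum_negf sum_divide_distrib[symmetric])
  finally show ?thesis
    by (simp only: std_normal_density_def prod.distrib prod_constant)
qed

lemma std_gaussian_distr_orthogonal_transformation:
  fixes f :: "real^'n \<Rightarrow> real^'n"
  assumes f: "orthogonal_transformation f"
  shows "distr std_gaussian borel f = std_gaussian"
proof -
  let ?\<phi> = "\<lambda>x::real^'n. ennreal (\<Prod>i\<in>UNIV. std_normal_density (x $ i))"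
  have [measurable]: "f \<in> borel_measurable borel"
    using f by (rule orthogonal_transformation_borel_measurable)
  have "density (distr lborel borel f) ?\<phi> = distr (density lborel (\<lambda>x. ?\<phi> (f x))) borel f"
    by (rule density_distr) (simp_all add: prod_std_normal_density)
  then show ?thesis
    using f by (simp add: lborel_distr_orthogonal_transformation std_gaussian_def
        prod_std_normal_density orthogonal_transformation_norm)
qed

lemma sets_std_gaussian [measurable_cong, simp]: "sets std_gaussian = sets borel"
  by (simp add: std_gaussian_def)

lemma space_std_gaussian [simp]: "space std_gaussian = UNIV"
  by (simp add: std_gaussian_def)

lemma AE_std_gaussian:
  assumes "AE x in lborel. P x"
  shows "AE x in std_gaussian. P x"
  using assms unfolding std_gaussian_def
  by (subst AE_density) (auto simp: prod_std_normal_density)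

section \<open>The second moments of the direction\<close>

lemma proj_mem_tangent:
  assumes "B *v v \<noteq> 0"
  shows "proj B v y \<in> tangent B v"
  using assms by (simp add: tangent_def proj_def inner_diff_left power2_norm_eq_inner)

lemma inner_proj_right:
  assumes "x \<in> tangent B v"
  shows "x \<bullet> proj B v y = x \<bullet> y"
  using assms by (simp add: tangent_def proj_def inner_diff_right)

lemma direction_mem_tangent:
  assumes "B *v v \<noteq> 0"
  shows "direction B v y \<in> tangent B v"
  using proj_mem_tangent[OF assms, of y] by (simp add: direction_def tangent_def)

lemma norm_direction_le: "norm (direction B v y) \<le> 1"
  by (cases "proj B v y = 0") (simp_all add: direction_def)

lemma direction_measurable [measurable]: "direction B v \<in> borel_measurable borel"
proof -
  have [measurable]: "proj B v \<in> borel_measurable borel"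
    unfolding proj_def by measurable
  show ?thesis unfolding direction_def by measurable
qed

text \<open>The Householder reflection in the hyperplane orthogonal to \<open>a\<close>. For
  \<open>a = 0\<close> the quotient is 0 and the map is the identity, so it is orthogonal in every
  case.\<close>

definition reflect_along :: "'a::real_inner \<Rightarrow> 'a \<Rightarrow> 'a" where
  "reflect_along a x = x - (2 * (x \<bullet> a) / (a \<bullet> a)) *\<^sub>R a"

lemma orthogonal_transformation_reflect_along: "orthogonal_transformation (reflect_along a)"
proof -
  have "linear (reflect_along a)"
    by (rule linearI)
      (simp_all add: reflect_along_def inner_add_left algebra_simps add_divide_distrib)
  moreover have "reflect_along a x \<bullet> reflect_along a y = x \<bullet> y" for x y
    by (simp add: reflect_along_def inner_diff_left inner_diff_right inner_commute)
  ultimately show ?thesis by (simp add: orthogonal_transformation_def)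
qed

text \<open>For equal norms the mirror is the perpendicular bisector of \<open>u\<close> and
  \<open>w\<close>; algebraically, the squared norm of \<open>u - w\<close> is twice
  \<open>u \<bullet> (u - w)\<close>.\<close>

lemma reflect_along_diff:
  assumes "norm u = norm w"
  shows "reflect_along (u - w) u = w"
proof (cases "u = w")
  case False
  have "u \<bullet> u = w \<bullet> w" using assms by (simp add: norm_eq)
  then have "(u - w) \<bullet> (u - w) = 2 * (u \<bullet> (u - w))"
    by (simp add: inner_diff_left inner_diff_right inner_commute)
  moreover have "(u - w) \<bullet> (u - w) \<noteq> 0" using False by simp
  ultimately have "2 * (u \<bullet> (u - w)) / ((u - w) \<bullet> (u - w)) = 1" by simp
  then show ?thesis by (simp only: reflect_along_def) simp
qed (simp add: reflect_along_def)

text \<open>A tangent \<open>a\<close> is orthogonal to \<open>B *v v\<close>, so the reflection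
  fixes that normal vector and commutes with the projection. Being an isometry, it also commutes
  with the normalization.\<close>

lemma direction_reflect_along:
  assumes a: "a \<in> tangent B v"
  shows "direction B v (reflect_along a y) = reflect_along a (direction B v y)"
proof -
  have o: "orthogonal_transformation (reflect_along a)"
    by (rule orthogonal_transformation_reflect_along)
  have "proj B v (reflect_along a y) = reflect_along a (proj B v y)"
    using a inner_commute[of a "B *v v"]
    by (simp add: proj_def reflect_along_def tangent_def inner_diff_left algebra_simps)
  then show ?thesis
    unfolding direction_def
    by (simp add: orthogonal_transformation_norm[OF o] orthogonal_transformation_scaleR[OF o])
qed

text \<open>Dimension at least two supplies a nonzero tangent vector \<open>u\<close>. A sample with
  zero projection is orthogonal to \<open>u\<close>, hence lies in a hyperplane, which is a null
  set.\<close>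

lemma AE_norm_direction:
  fixes B :: "real^'n^'n"
  assumes d: "CARD('n) \<ge> 2" and Bv: "B *v v \<noteq> 0"
  shows "AE y in std_gaussian. norm (direction B v y) = 1"
proof -
  obtain u :: "real^'n" where u: "u \<noteq> 0" "orthogonal (B *v v) u"
    using orthogonal_to_vector_exists[of "B *v v"] d by auto
  then have ut: "u \<in> tangent B v" by (simp add: tangent_def orthogonal_def inner_commute)
  have "{y. u \<bullet> y = 0} \<in> null_sets lborel"
    using negligible_hyperplane[of u 0] u
    by (simp add: negligible_iff_null_sets null_sets_completion_iff closed_hyperplane borel_closed)
  then have "AE y in lborel. u \<bullet> y \<noteq> 0"
    by (rule AE_I') auto
  then have "AE y in std_gaussian. u \<bullet> y \<noteq> 0" by (rule AE_std_gaussian)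
  then show ?thesis
  proof eventually_elim
    case (elim y)
    then have "proj B v y \<noteq> 0" using inner_proj_right[OF ut, of y] by auto
    then show ?case by (simp add: direction_def)
  qed
qed

text \<open>Every direction lies in the closed unit ball, where continuity and compactness bound
  \<open>h\<close>; bounded measurable functions are integrable for a probability measure.\<close>

lemma integrable_direction:
  fixes h :: "real^'n \<Rightarrow> 'b::{banach, second_countable_topology}"
  assumes h: "continuous_on UNIV h"
  shows "integrable std_gaussian (\<lambda>y. h (direction B v y))"
proof -
  interpret prob_space "std_gaussian :: (real^'n) measure" by (rule prob_space_std_gaussian)
  have [measurable]: "h \<in> borel_measurable borel"
    using h by (rule borel_measurable_continuous_onI)
  have "compact (h ` cball 0 1)"
    by (rule compact_continuous_image[OF continuous_on_subset[OF h subset_UNIV] compact_cball])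
  then have "bounded (h ` cball 0 1)" by (rule compact_imp_bounded)
  then obtain K where K: "\<forall>z\<in>h ` cball 0 1. norm z \<le> K"
    unfolding bounded_iff by (rule exE)
  have le: "norm (h (direction B v y)) \<le> K" for y
    by (rule bspec[OF K]) (simp add: norm_direction_le)
  show ?thesis
    by (rule integrable_const_bound[where B=K]) (simp add: le, measurable)
qed

text \<open>The reflection along \<open>u - w\<close> carries \<open>u\<close> to \<open>w\<close>,
  preserves the Gaussian and commutes with \<open>direction\<close>; a change of variables does the
  rest.\<close>

lemma direction_second_moment_cong:
  assumes u: "u \<in> tangent B v" and w: "w \<in> tangent B v" and n: "norm u = norm w"
  shows "(LINT y|std_gaussian. (direction B v y \<bullet> u)\<^sup>2) =
    (LINT y|std_gaussian. (direction B v y \<bullet> w)\<^sup>2)"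
proof -
  let ?R = "reflect_along (u - w)"
  have o: "orthogonal_transformation ?R"
    by (rule orthogonal_transformation_reflect_along)
  then have [measurable]: "?R \<in> borel_measurable borel"
    by (rule orthogonal_transformation_borel_measurable)
  have a: "u - w \<in> tangent B v" using u w by (simp add: tangent_def inner_diff_left)
  have "(LINT y|std_gaussian. (direction B v y \<bullet> w)\<^sup>2) =
      (LINT y|distr std_gaussian borel ?R. (direction B v y \<bullet> w)\<^sup>2)"
    by (simp add: std_gaussian_distr_orthogonal_transformation[OF o])
  also have "\<dots> = (LINT y|std_gaussian. (?R (direction B v y) \<bullet> ?R u)\<^sup>2)"
    by (subst integral_distr) (simp_all add: direction_reflect_along[OF a] reflect_along_diff[OF n])
  also have "\<dots> = (LINT y|std_gaussian. (direction B v y \<bullet> u)\<^sup>2)"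
    using o by (simp add: orthogonal_transformation_def)
  finally show ?thesis by simp
qed

text \<open>By \<open>direction_second_moment_cong\<close> the second moments are proportional to \<open>(norm u)\<^sup>2\<close> on the
  tangent space; the trace identity \<open>\<Sum>i (direction B v y \<bullet> axis i 1)\<^sup>2 = 1\<close> fixes the constant.\<close>
lemma direction_second_moment:
  fixes B :: "real^'n^'n"
  assumes d: "CARD('n) \<ge> 2" and Bv: "B *v v \<noteq> 0" and u: "u \<in> tangent B v"
  shows "(LINT y|std_gaussian. (direction B v y \<bullet> u)\<^sup>2) = (norm u)\<^sup>2 / (real CARD('n) - 1)"
proof -
  interpret prob_space "std_gaussian :: (real^'n) measure" by (rule prob_space_std_gaussian)
  let ?D = "direction B v"
  let ?Q = "\<lambda>u. LINT y|std_gaussian. (?D y \<bullet> u)\<^sup>2"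
  \<comment> \<open>The projected axes replace an orthonormal basis of the tangent space: pairing a
    tangent vector with them reads off its coordinates, and their squared norms sum to the trace of
    the projection, \<open>real CARD('n) - 1\<close>.\<close>
  let ?e = "\<lambda>i. proj B v (axis i 1)"
  have scale: "?Q (c *\<^sub>R w) = c\<^sup>2 * ?Q w" for c w
    by (simp add: power_mult_distrib)
  have e: "?e i \<in> tangent B v" for i using proj_mem_tangent[OF Bv] .
  \<comment> \<open>Rescaling both vectors to a common norm, instead of dividing, also covers a
    projected axis that vanishes because the axis is parallel to \<open>B *v v\<close>.\<close>
  have cross: "(norm u)\<^sup>2 * ?Q (?e i) = (norm (?e i))\<^sup>2 * ?Q u" for i
  proof -
    have "?Q (norm u *\<^sub>R ?e i) = ?Q (norm (?e i) *\<^sub>R u)"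
      by (rule direction_second_moment_cong) (use e u in \<open>auto simp: tangent_def\<close>)
    then show ?thesis by (simp only: scale)
  qed
  have De: "?D y \<bullet> ?e i = ?D y $ i" for y i
    using inner_proj_right[OF direction_mem_tangent[OF Bv]] by (simp add: inner_axis)
  have norm_e: "(norm (?e i))\<^sup>2 = 1 - ((B *v v) $ i)\<^sup>2 / (norm (B *v v))\<^sup>2" for i
  proof -
    have "(norm (?e i))\<^sup>2 = ?e i \<bullet> axis i 1"
      using inner_proj_right[OF e] by (simp add: power2_norm_eq_inner)
    then show ?thesis
      by (simp add: proj_def inner_diff_left inner_axis inner_axis' power2_eq_square)
  qed
  have "(\<Sum>i\<in>UNIV. ?Q (?e i)) = (LINT y|std_gaussian. (\<Sum>i\<in>UNIV. (?D y \<bullet> ?e i)\<^sup>2))"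
    by (rule Bochner_Integration.integral_sum[symmetric], rule integrable_direction)
      (intro continuous_intros)
  also have "\<dots> = (LINT y|std_gaussian. (norm (?D y))\<^sup>2)"
    by (simp add: De power2_norm_eq_sum_cart)
  also have "\<dots> = (LINT y|(std_gaussian :: (real^'n) measure). 1)"
    by (rule integral_cong_AE) (use AE_norm_direction[OF d Bv] in auto)
  also have "\<dots> = 1" using prob_space by simp
  finally have trace: "(\<Sum>i\<in>UNIV. ?Q (?e i)) = 1" .
  have "(\<Sum>i\<in>UNIV. (norm (?e i))\<^sup>2) = real CARD('n) - 1"
    unfolding norm_e sum_subtractf sum_divide_distrib[symmetric] power2_norm_eq_sum_cart[symmetric]
    using Bv by simp
  moreover have "(norm u)\<^sup>2 * (\<Sum>i\<in>UNIV. ?Q (?e i)) = (\<Sum>i\<in>UNIV. (norm (?e i))\<^sup>2) * ?Q u"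
    by (simp only: sum_distrib_left sum_distrib_right cross)
  ultimately have "(norm u)\<^sup>2 = (real CARD('n) - 1) * ?Q u"
    using trace by simp
  then show ?thesis using d by (simp add: field_simps)
qed

text \<open>Polarization: the product is a quarter of the difference of the squares taken at
  \<open>u + w\<close> and \<open>u - w\<close>, which are again tangent.\<close>

lemma direction_mixed_moment:
  fixes B :: "real^'n^'n"
  assumes d: "CARD('n) \<ge> 2" and Bv: "B *v v \<noteq> 0"
    and u: "u \<in> tangent B v" and w: "w \<in> tangent B v"
  shows "(LINT y|std_gaussian. (direction B v y \<bullet> u) * (direction B v y \<bullet> w)) =
    (u \<bullet> w) / (real CARD('n) - 1)"
proof -
  let ?D = "direction B v"
  have t: "u + w \<in> tangent B v" "u - w \<in> tangent B v"
    using u w by (auto simp: tangent_def inner_add_left inner_diff_left)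
  have i: "integrable std_gaussian (\<lambda>y. (?D y \<bullet> z)\<^sup>2)" for z
    by (rule integrable_direction) (intro continuous_intros)
  have "(LINT y|std_gaussian. (?D y \<bullet> u) * (?D y \<bullet> w)) =
      (LINT y|std_gaussian. ((?D y \<bullet> (u + w))\<^sup>2 - (?D y \<bullet> (u - w))\<^sup>2) / 4)"
    by (rule Bochner_Integration.integral_cong)
      (simp_all add: inner_add_right inner_diff_right power2_eq_square algebra_simps)
  also have "\<dots> = ((norm (u + w))\<^sup>2 / (real CARD('n) - 1) - (norm (u - w))\<^sup>2 / (real CARD('n) - 1)) / 4"
    using i by (simp add: direction_second_moment[OF d Bv] t)
  also have "\<dots> = ((norm (u + w))\<^sup>2 - (norm (u - w))\<^sup>2) / 4 / (real CARD('n) - 1)"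
    by (simp add: diff_divide_distrib mult.commute)
  also have "((norm (u + w))\<^sup>2 - (norm (u - w))\<^sup>2) / 4 = u \<bullet> w"
    by (simp add: power2_norm_eq_inner inner_add_left inner_add_right inner_diff_left
        inner_diff_right inner_commute)
  finally show ?thesis .
qed

lemma direction_moment_vector:
  fixes B :: "real^'n^'n"
  assumes d: "CARD('n) \<ge> 2" and Bv: "B *v v \<noteq> 0" and g: "g \<in> tangent B v"
  shows "(LINT y|std_gaussian. (direction B v y \<bullet> g) *\<^sub>R direction B v y) =
    (1 / (real CARD('n) - 1)) *\<^sub>R g" (is "?I = _")
proof (rule vector_eq_rdot[THEN iffD1, rule_format])
  fix z
  let ?D = "direction B v"
  have i: "integrable std_gaussian (\<lambda>y. (?D y \<bullet> g) *\<^sub>R ?D y)"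
    by (rule integrable_direction) (intro continuous_intros)
  have "?I \<bullet> z = (LINT y|std_gaussian. (?D y \<bullet> g) * (?D y \<bullet> z))"
    using i by (simp flip: integral_inner_left)
  \<comment> \<open>The direction is tangent, so it pairs equally with \<open>z\<close> and with its
    projection, to which the mixed moment formula applies.\<close>
  also have "\<dots> = (LINT y|std_gaussian. (?D y \<bullet> g) * (?D y \<bullet> proj B v z))"
    using inner_proj_right[OF direction_mem_tangent[OF Bv]] by simp
  also have "\<dots> = (g \<bullet> z) / (real CARD('n) - 1)"
    by (simp add: direction_mixed_moment[OF d Bv g proj_mem_tangent[OF Bv]] inner_proj_right[OF g])
  finally show "?I \<bullet> z = ((1 / (real CARD('n) - 1)) *\<^sub>R g) \<bullet> z" by simp
qed

section \<open>Application to the Riemannian gradient\<close>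

lemma riem_grad_inner:
  assumes "x \<in> tangent B v"
  shows "x \<bullet> riem_grad A B v = b_coeff A v x"
  using inner_proj_right[OF assms] by (simp add: riem_grad_def b_coeff_def)

theorem theorem7p1:
  fixes A B :: "real^'n^'n" and v :: "real^'n" and f :: "real^'n \<Rightarrow> real"
  assumes "CARD('n) \<ge> 2"
    and "spd B"
    and "\<And>w. w \<in> sphere_wrt B \<Longrightarrow> f w = w \<bullet> (A *v w)"
    and "v \<in> sphere_wrt B"
  shows "(\<forall>y. let x = direction B v y in
            b_coeff A v x *\<^sub>R x = 2 *\<^sub>R grad_est B f v x (step_size A B v x)) \<and>
         integrable (direction_law B v) (\<lambda>x. b_coeff A v x *\<^sub>R x) \<and>
         (LINT x | direction_law B v. b_coeff A v x *\<^sub>R x) =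
            (1 / (real CARD('n) - 1)) *\<^sub>R riem_grad A B v"
proof -
  have Bv: "B *v v \<noteq> 0"
    using assms(4) by (auto simp: sphere_wrt_def norm_wrt_def)
  let ?D = "direction B v"
  have cont: "continuous_on UNIV (\<lambda>x. b_coeff A v x *\<^sub>R x)"
    unfolding b_coeff_def by (intro continuous_intros)
  then have [measurable]: "(\<lambda>x. b_coeff A v x *\<^sub>R x) \<in> borel_measurable borel"
    by (rule borel_measurable_continuous_onI)
  have g: "riem_grad A B v \<in> tangent B v"
    using proj_mem_tangent[OF Bv] by (simp add: riem_grad_def tangent_def)
  \<comment> \<open>The coefficient of a tangent direction is its inner product with the Riemannian
    gradient, so the vector moment formula applies with the gradient as \<open>g\<close>.\<close>
  have "(LINT y|std_gaussian. b_coeff A v (?D y) *\<^sub>R ?D y) =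
      (1 / (real CARD('n) - 1)) *\<^sub>R riem_grad A B v"
    using direction_moment_vector[OF assms(1) Bv g]
    by (simp add: riem_grad_inner[OF direction_mem_tangent[OF Bv]])
  moreover have "integrable (direction_law B v) (\<lambda>x. b_coeff A v x *\<^sub>R x)"
    unfolding direction_law_def
    using integrable_direction[OF cont] by (subst integrable_distr_eq) simp_all
  moreover have "(LINT x | direction_law B v. b_coeff A v x *\<^sub>R x) =
      (LINT y|std_gaussian. b_coeff A v (?D y) *\<^sub>R ?D y)"
    unfolding direction_law_def by (rule integral_distr) simp_all
  ultimately show ?thesis
    using grad_est_step_size[OF assms(2,4) direction_mem_tangent[OF Bv] assms(3)]
    by (simp add: Let_def)
qed

end
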